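(* Let $p,q,r$ be three distinct primes and let $a,b$ be positive integers such that $qr\mid p^a-1$ and $pr\mid q^b-1$. Let $\phi:C_q\hookrightarrow \mathbb F_{p^a}^\times$, $\psi:C_p\hookrightarrow \mathbb F_{q^b}^\times$, $\rho_1:C_r\hookrightarrow \mathbb F_{p^a}^\times$ and $\rho_2:C_r\hookrightarrow \mathbb F_{q^b}^\times$ be injective group homomorphisms. Let $$H_1=\mathbb F_{p^a}^+\rtimes_\phi C_q,\qquad H_2=\mathbb F_{q^b}^+\rtimes_\psi C_p,$$ and let $$G=(H_1\times H_2)\rtimes_{\rho_1,\rho_2} C_r,$$ where $C_r$ acts on $H_1$ via $\rho_1$ on $\mathbb F_{p^a}^+$ and trivially on $C_q$, and acts on $H_2$ via $\rho_2$ on $\mathbb F_{q^b}^+$ and trivially on $C_p$. Then $G$ is a metabelian $A$-group which is not an $A'$-group.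
   Context: $C_n$ denotes the cyclic group with $n$ elements. $\mathbb F_{m}$ is the finite field with $m$ elements, $\mathbb F_m^+$ its additive group and $\mathbb F_m^\times$ its multiplicative group. The group $\mathbb F_m^\times$ acts on $\mathbb F_m^+$ by multiplication, and a homomorphism from a group $C$ to $\mathbb F_m^\times$ thus gives an action of $C$ on $\mathbb F_m^+$ by automorphisms; the semidirect products $\mathbb F_{p^a}^+\rtimes_\phi C_q$ and $\mathbb F_{q^b}^+\rtimes_\psi C_p$ are formed with respect to these actions. Since $\mathbb F_{p^a}^\times$ and $\mathbb F_{q^b}^\times$ are abelian, the maps $(x,c)\mapsto(\rho_1(t)x,c)$ on $H_1$ and $(y,d)\mapsto(\rho_2(t)y,d)$ on $H_2$, for $t\in C_r$, are group automorphisms and define the actions of $C_r$ on $H_1$ and $H_2$ (hence, componentwise, on $H_1\times H_2$). An $A$-group is a finite group all of whose Sylow subgroups are abelian. A group is metabelian if it has an abelian normal subgroup with abelian quotient. The class of $A'$-groups is the class of finite groups defined inductively (up to isomorphism) by the following rules: (1) Finite abelian groups are $A'$-groups. (2) If $\mathcal G$ is an $A'$-group and $H$ is a finite abelian group of order prime to that of $\mathcal G$, then the semidirect product $H\rtimes_\mu \mathcal G$ is an $A'$-group, for any action $\mu$ of $\mathcal G$ on $H$ (by group automorphisms). (3) If $\mathcal G_1$ and $\mathcal G_2$ are $A'$-groups, then $\mathcal G_1\times \mathcal G_2$ is an $A'$-group. A group is an $A'$-group only if it is obtained by finitely many applications of these rules. *)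

theory Defs
  imports "HOL-Algebra.Algebra"
begin

section \<open>Semidirect products\<close>

text \<open>An action of a group \<open>Q\<close> on a group \<open>N\<close> by automorphisms is an element of
  \<open>hom Q (AutoGroup N)\<close>; automorphisms in \<^const>\<open>AutoGroup\<close> are extensional functions,
  which is why the concrete actions below use restricted abstractions.\<close>

definition semidirect ::
    "('a, 'm) monoid_scheme \<Rightarrow> ('b, 'n) monoid_scheme \<Rightarrow> ('b \<Rightarrow> 'a \<Rightarrow> 'a) \<Rightarrow> ('a \<times> 'b) monoid" where
  "semidirect N Q \<mu> =
    \<lparr>carrier = carrier N \<times> carrier Q,
     monoid.mult = (\<lambda>(x, s) (y, t). (x \<otimes>\<^bsub>N\<^esub> \<mu> s y, s \<otimes>\<^bsub>Q\<^esub> t)),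
     one = (\<one>\<^bsub>N\<^esub>, \<one>\<^bsub>Q\<^esub>)\<rparr>"

lemma carrier_semidirect [simp]:
  "carrier (semidirect N Q \<mu>) = carrier N \<times> carrier Q"
  by (simp add: semidirect_def)

lemma mult_semidirect [simp]:
  "(x, s) \<otimes>\<^bsub>semidirect N Q \<mu>\<^esub> (y, t) = (x \<otimes>\<^bsub>N\<^esub> \<mu> s y, s \<otimes>\<^bsub>Q\<^esub> t)"
  by (simp add: semidirect_def)

lemma one_semidirect [simp]: "\<one>\<^bsub>semidirect N Q \<mu>\<^esub> = (\<one>\<^bsub>N\<^esub>, \<one>\<^bsub>Q\<^esub>)"
  by (simp add: semidirect_def)

lemma hom_AutoGroup_iff:
  assumes "group N" "group Q"
  shows "\<mu> \<in> hom Q (AutoGroup N) \<longleftrightarrow>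
    (\<forall>s\<in>carrier Q. \<mu> s \<in> extensional (carrier N) \<and> bij_betw (\<mu> s) (carrier N) (carrier N) \<and>
      (\<forall>x\<in>carrier N. \<forall>y\<in>carrier N. \<mu> s (x \<otimes>\<^bsub>N\<^esub> y) = \<mu> s x \<otimes>\<^bsub>N\<^esub> \<mu> s y)) \<and>
    (\<forall>s\<in>carrier Q. \<forall>t\<in>carrier Q. \<forall>x\<in>carrier N. \<mu> (s \<otimes>\<^bsub>Q\<^esub> t) x = \<mu> s (\<mu> t x))"
  (is "?L \<longleftrightarrow> ?R")
proof
  assume L: ?L
  have B: "\<mu> s \<in> Bij (carrier N)" "\<mu> s \<in> hom N N" if "s \<in> carrier Q" for s
    using hom_in_carrier[OF L that] by (simp_all add: AutoGroup_def auto_def)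
  have C: "\<mu> (s \<otimes>\<^bsub>Q\<^esub> t) = compose (carrier N) (\<mu> s) (\<mu> t)"
    if "s \<in> carrier Q" "t \<in> carrier Q" for s t
    using hom_mult[OF L that] B(1)[OF that(1)] B(1)[OF that(2)]
    by (simp add: AutoGroup_def BijGroup_def)
  show ?R
  proof (intro conjI ballI)
    fix s assume s: "s \<in> carrier Q"
    show "\<mu> s \<in> extensional (carrier N)" "bij_betw (\<mu> s) (carrier N) (carrier N)"
      using B(1)[OF s] by (simp_all add: Bij_def)
    show "\<mu> s (x \<otimes>\<^bsub>N\<^esub> y) = \<mu> s x \<otimes>\<^bsub>N\<^esub> \<mu> s y" if "x \<in> carrier N" "y \<in> carrier N" for x y
      using hom_mult[OF B(2)[OF s] that] .
    show "\<mu> (s \<otimes>\<^bsub>Q\<^esub> t) x = \<mu> s (\<mu> t x)" if "t \<in> carrier Q" "x \<in> carrier N" for t x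
      using C[OF s that(1)] that(2) by (simp add: compose_eq)
  qed
next
  assume R: ?R
  have B: "\<mu> s \<in> Bij (carrier N)" "\<mu> s \<in> hom N N" if "s \<in> carrier Q" for s
  proof -
    show "\<mu> s \<in> Bij (carrier N)"
      using R that by (simp add: Bij_def)
    show "\<mu> s \<in> hom N N"
      using R that by (intro homI) (metis bij_betwE, metis)
  qed
  have C: "\<mu> (s \<otimes>\<^bsub>Q\<^esub> t) = compose (carrier N) (\<mu> s) (\<mu> t)"
    if st: "s \<in> carrier Q" "t \<in> carrier Q" for s t
  proof (rule extensionalityI[of _ "carrier N"])
    show "\<mu> (s \<otimes>\<^bsub>Q\<^esub> t) \<in> extensional (carrier N)"
      using R monoid.m_closed[OF group.is_monoid[OF assms(2)] st] by blast
    show "\<mu> (s \<otimes>\<^bsub>Q\<^esub> t) x = compose (carrier N) (\<mu> s) (\<mu> t) x" if "x \<in> carrier N" for x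
      using R st that by (metis compose_eq)
  qed (rule compose_extensional)
  show ?L
  proof (rule homI)
    show "\<mu> s \<in> carrier (AutoGroup N)" if "s \<in> carrier Q" for s
      using B[OF that] by (simp add: AutoGroup_def auto_def)
    show "\<mu> (s \<otimes>\<^bsub>Q\<^esub> t) = \<mu> s \<otimes>\<^bsub>AutoGroup N\<^esub> \<mu> t" if "s \<in> carrier Q" "t \<in> carrier Q" for s t
      using C[OF that] B(1)[OF that(1)] B(1)[OF that(2)] by (simp add: AutoGroup_def BijGroup_def)
  qed
qed

lemma group_semidirect:
  assumes "group N" "group Q" and mu: "\<mu> \<in> hom Q (AutoGroup N)"
  shows "group (semidirect N Q \<mu>)"
proof -
  interpret N: group N by fact
  interpret Q: group Q by fact
  note R = mu[unfolded hom_AutoGroup_iff[OF assms(1,2)]]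
  have cl [simp]: "\<mu> s x \<in> carrier N" if "s \<in> carrier Q" "x \<in> carrier N" for s x
    using R that bij_betwE by blast
  have id: "\<mu> \<one>\<^bsub>Q\<^esub> x = x" if x: "x \<in> carrier N" for x
  proof -
    have "\<mu> \<one>\<^bsub>Q\<^esub> (\<mu> \<one>\<^bsub>Q\<^esub> x) = \<mu> \<one>\<^bsub>Q\<^esub> x"
      using R x by (metis Q.l_one Q.one_closed)
    moreover have "inj_on (\<mu> \<one>\<^bsub>Q\<^esub>) (carrier N)"
      using R by (auto simp: bij_betw_def)
    ultimately show ?thesis
      using x by (auto dest: inj_onD)
  qed
  have one: "\<mu> s \<one>\<^bsub>N\<^esub> = \<one>\<^bsub>N\<^esub>" if "s \<in> carrier Q" for s
    using R that by (metis N.l_one N.one_closed N.r_cancel_one cl)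
  show ?thesis
  proof (rule groupI)
    fix u assume "u \<in> carrier (semidirect N Q \<mu>)"
    then obtain x s where u: "u = (x, s)" "x \<in> carrier N" "s \<in> carrier Q" by auto
    let ?v = "(\<mu> (inv\<^bsub>Q\<^esub> s) (inv\<^bsub>N\<^esub> x), inv\<^bsub>Q\<^esub> s)"
    have "\<mu> (inv\<^bsub>Q\<^esub> s) (inv\<^bsub>N\<^esub> x) \<otimes>\<^bsub>N\<^esub> \<mu> (inv\<^bsub>Q\<^esub> s) x = \<mu> (inv\<^bsub>Q\<^esub> s) (inv\<^bsub>N\<^esub> x \<otimes>\<^bsub>N\<^esub> x)"
      using R u by (metis N.inv_closed Q.inv_closed)
    then have "?v \<otimes>\<^bsub>semidirect N Q \<mu>\<^esub> u = \<one>\<^bsub>semidirect N Q \<mu>\<^esub>"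
      using u one by simp
    then show "\<exists>v\<in>carrier (semidirect N Q \<mu>). v \<otimes>\<^bsub>semidirect N Q \<mu>\<^esub> u = \<one>\<^bsub>semidirect N Q \<mu>\<^esub>"
      using u by (intro bexI[of _ ?v]) auto
  qed (use R in \<open>auto simp: id one N.m_assoc Q.m_assoc\<close>)
qed


section \<open>Classes of finite groups\<close>

definition metabelian_group :: "('a, 'm) monoid_scheme \<Rightarrow> bool" where
  "metabelian_group G \<longleftrightarrow>
    (\<exists>N. N \<lhd> G \<and> comm_group (G\<lparr>carrier := N\<rparr>) \<and> comm_group (G Mod N))"

definition sylow_subgroup :: "nat \<Rightarrow> 'a set \<Rightarrow> ('a, 'm) monoid_scheme \<Rightarrow> bool" where
  "sylow_subgroup p P G \<longleftrightarrow> subgroup P G \<and> card P = p ^ multiplicity p (order G)"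

definition A_group :: "('a, 'm) monoid_scheme \<Rightarrow> bool" where
  "A_group G \<longleftrightarrow> group G \<and> finite (carrier G) \<and>
    (\<forall>p P. Factorial_Ring.prime p \<and> sylow_subgroup p P G \<longrightarrow> comm_group (G\<lparr>carrier := P\<rparr>))"

text \<open>An inductive predicate lives on one type, whereas the rules generating the \<open>A'\<close>-groups
  change the type of the carrier. Since every finite group has an isomorphic copy on a set of
  natural numbers and the class is only defined up to isomorphism, the rules are stated for
  groups with elements in \<^typ>\<open>nat\<close>, with closure under isomorphism built in, and then
  transported to arbitrary types. The lemmas \<open>A'_group_abelian\<close>, \<open>A'_group_semidirect\<close>,
  \<open>A'_group_DirProd\<close> and \<open>A'_group_iso\<close> show that nothing is lost.\<close>

inductive A'_nat :: "nat monoid \<Rightarrow> bool" where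
  abelian: "\<lbrakk>comm_group K; finite (carrier K)\<rbrakk> \<Longrightarrow> A'_nat K"
| semidirect: "\<lbrakk>A'_nat G; comm_group (H :: nat monoid); finite (carrier H); coprime (order H) (order G);
    \<mu> \<in> hom G (AutoGroup H); group K; K \<cong> semidirect H G \<mu>\<rbrakk> \<Longrightarrow> A'_nat K"
| product: "\<lbrakk>A'_nat G1; A'_nat G2; group K; K \<cong> G1 \<times>\<times> G2\<rbrakk> \<Longrightarrow> A'_nat K"

definition A'_group :: "('a, 'm) monoid_scheme \<Rightarrow> bool" where
  "A'_group G \<longleftrightarrow> group G \<and> (\<exists>K. A'_nat K \<and> G \<cong> K)"

lemma A'_nat_finite_group: "A'_nat K \<Longrightarrow> group K \<and> finite (carrier K)"
proof (induction rule: A'_nat.induct)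
  case (semidirect G H \<mu> K)
  then show ?case
    by (auto simp: is_iso_def iso_def dest: bij_betw_finite)
next
  case (product G1 G2 K)
  then show ?case
    by (auto simp: is_iso_def iso_def DirProd_def dest: bij_betw_finite)
qed (auto simp: comm_group_def)

lemma nat_copy:
  assumes "group G" "finite (carrier G)"
  obtains K :: "nat monoid" and h where "group K" "h \<in> iso G K"
proof -
  interpret group G by fact
  obtain f where f: "bij_betw f (carrier G) {0..<card (carrier G)}"
    using ex_bij_betw_finite_nat assms(2) by blast
  define g where "g = inv_into (carrier G) f"
  define K where "K = \<lparr>carrier = {0..<card (carrier G)},
    monoid.mult = (\<lambda>x y. f (g x \<otimes>\<^bsub>G\<^esub> g y)), one = f \<one>\<^bsub>G\<^esub>\<rparr>"
  have gf: "g (f x) = x" if "x \<in> carrier G" for x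
    using f that by (simp add: g_def bij_betw_def)
  have "f \<in> iso G K"
    using f bij_betwE[OF f] by (auto simp: iso_def hom_def K_def gf)
  moreover have "K\<lparr>one := f \<one>\<^bsub>G\<^esub>\<rparr> = K" by (simp add: K_def)
  ultimately show ?thesis
    using iso_imp_img_group that by metis
qed

lemma A'_group_iso:
  assumes "A'_group G" "group L" "L \<cong> G"
  shows "A'_group L"
  using assms iso_trans by (auto simp: A'_group_def)

lemma A'_group_abelian:
  assumes "comm_group G" "finite (carrier G)"
  shows "A'_group G"
proof -
  interpret comm_group G by fact
  obtain K :: "nat monoid" and h where K: "group K" "h \<in> iso G K"
    using nat_copy assms is_group by blast
  have "comm_group K" using iso_imp_comm_group[of K] K group.is_monoid[OF K(1)]
    by (meson is_isoI)
  moreover have "finite (carrier K)"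
    using K assms by (auto simp: iso_def dest: bij_betw_finite)
  ultimately show ?thesis
    using K is_group by (auto simp: A'_group_def intro: A'_nat.abelian is_isoI)
qed


lemma A'_group_finite_group:
  assumes "A'_group G"
  shows "group G" "finite (carrier G)"
  using assms A'_nat_finite_group
  by (auto simp: A'_group_def is_iso_def iso_def dest: bij_betw_finite)

lemma A'_group_DirProd:
  assumes "A'_group G1" "A'_group G2"
  shows "A'_group (G1 \<times>\<times> G2)"
proof -
  interpret G1: group G1 using A'_group_finite_group assms by blast
  interpret G2: group G2 using A'_group_finite_group assms by blast
  obtain K1 K2 h1 h2 where K: "A'_nat K1" "A'_nat K2" "h1 \<in> iso G1 K1" "h2 \<in> iso G2 K2"
    using assms by (auto simp: A'_group_def is_iso_def)
  have grp: "group (G1 \<times>\<times> G2)"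
    by (simp add: DirProd_group)
  have iso: "G1 \<times>\<times> G2 \<cong> K1 \<times>\<times> K2"
    using G1.DirProd_iso_set_trans[OF K(3,4)] is_isoI by blast
  have "finite (carrier (G1 \<times>\<times> G2))"
    using A'_group_finite_group(2)[OF assms(1)] A'_group_finite_group(2)[OF assms(2)]
    by (simp add: DirProd_def)
  then obtain K :: "nat monoid" and h where "group K" "h \<in> iso (G1 \<times>\<times> G2) K"
    using nat_copy grp by blast
  moreover from this have "K \<cong> K1 \<times>\<times> K2"
    using iso iso_trans group.iso_sym[OF grp] is_isoI by blast
  ultimately show ?thesis
    using A'_nat.product[OF K(1,2)] grp is_isoI unfolding A'_group_def by blast
qed

lemma A'_group_semidirect:
  assumes G: "A'_group G" and H: "comm_group H" "finite (carrier H)"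
    and cop: "coprime (order H) (order G)" and mu: "\<mu> \<in> hom G (AutoGroup H)"
  shows "A'_group (semidirect H G \<mu>)"
proof -
  interpret G: group G using A'_group_finite_group G by blast
  interpret H: comm_group H by fact
  obtain G0 g where G0: "A'_nat G0" "g \<in> iso G G0"
    using G by (auto simp: A'_group_def is_iso_def)
  obtain H0 :: "nat monoid" and h where H0: "group H0" "h \<in> iso H H0"
    using nat_copy[OF H.is_group H(2)] .
  interpret G0: group G0 using A'_nat_finite_group G0 by blast
  interpret H0: group H0 by fact
  have cH0: "comm_group H0"
    using H.iso_imp_comm_group[of H0] H0 H0.is_monoid is_isoI by blast
  have bij: "bij_betw g (carrier G) (carrier G0)" "bij_betw h (carrier H) (carrier H0)"
    using G0 H0 by (auto simp: iso_def)
  define g' where "g' = inv_into (carrier G) g"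
  define h' where "h' = inv_into (carrier H) h"
  have isos: "g' \<in> iso G0 G" "h' \<in> iso H0 H"
    using G.iso_set_sym[OF G0(2)] H.iso_set_sym[OF H0(2)] by (simp_all add: g'_def h'_def)
  have inv [simp]: "\<And>x. x \<in> carrier G \<Longrightarrow> g' (g x) = x" "\<And>x. x \<in> carrier H \<Longrightarrow> h' (h x) = x"
    "\<And>x. x \<in> carrier H0 \<Longrightarrow> h (h' x) = x"
    using bij by (auto simp: g'_def h'_def bij_betw_def f_inv_into_f)
  have bij': "bij_betw h' (carrier H0) (carrier H)" using isos by (simp add: iso_def)
  have cl [simp]: "\<And>x. x \<in> carrier G \<Longrightarrow> g x \<in> carrier G0" "\<And>x. x \<in> carrier H \<Longrightarrow> h x \<in> carrier H0"
    "\<And>x. x \<in> carrier G0 \<Longrightarrow> g' x \<in> carrier G" "\<And>x. x \<in> carrier H0 \<Longrightarrow> h' x \<in> carrier H"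
    using G0(2) H0(2) isos by (auto simp: iso_def hom_def)
  have hom [simp]:
    "\<And>x y. \<lbrakk>x \<in> carrier G; y \<in> carrier G\<rbrakk> \<Longrightarrow> g (x \<otimes>\<^bsub>G\<^esub> y) = g x \<otimes>\<^bsub>G0\<^esub> g y"
    "\<And>x y. \<lbrakk>x \<in> carrier H; y \<in> carrier H\<rbrakk> \<Longrightarrow> h (x \<otimes>\<^bsub>H\<^esub> y) = h x \<otimes>\<^bsub>H0\<^esub> h y"
    "\<And>x y. \<lbrakk>x \<in> carrier G0; y \<in> carrier G0\<rbrakk> \<Longrightarrow> g' (x \<otimes>\<^bsub>G0\<^esub> y) = g' x \<otimes>\<^bsub>G\<^esub> g' y"
    "\<And>x y. \<lbrakk>x \<in> carrier H0; y \<in> carrier H0\<rbrakk> \<Longrightarrow> h' (x \<otimes>\<^bsub>H0\<^esub> y) = h' x \<otimes>\<^bsub>H\<^esub> h' y"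
    using G0(2) H0(2) isos by (auto simp: iso_def hom_def)
  note R = mu[unfolded hom_AutoGroup_iff[OF H.is_group G.is_group]]
  have mcl [simp]: "\<mu> s x \<in> carrier H" if "s \<in> carrier G" "x \<in> carrier H" for s x
    using R that bij_betwE by blast
  define \<nu> where "\<nu> s = (\<lambda>x\<in>carrier H0. h (\<mu> (g' s) (h' x)))" for s
  have "bij_betw (\<nu> s) (carrier H0) (carrier H0)" if "s \<in> carrier G0" for s
  proof -
    have "bij_betw (h \<circ> (\<mu> (g' s) \<circ> h')) (carrier H0) (carrier H0)"
      using R that bij bij' by (intro bij_betw_trans) auto
    then show ?thesis
      by (rule bij_betw_cong[THEN iffD1, rotated]) (simp add: \<nu>_def)
  qed
  then have nu: "\<nu> \<in> hom G0 (AutoGroup H0)"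
    using R unfolding hom_AutoGroup_iff[OF H0.is_group G0.is_group] by (auto simp: \<nu>_def)
  have grp: "group (semidirect H G \<mu>)"
    using group_semidirect mu H.is_group G.is_group by blast
  have "(\<lambda>(x, s). (h x, g s)) \<in> hom (semidirect H G \<mu>) (semidirect H0 G0 \<nu>)"
    by (auto simp: hom_def \<nu>_def)
  moreover have "bij_betw (\<lambda>(x, s). (h x, g s)) (carrier H \<times> carrier G) (carrier H0 \<times> carrier G0)"
    using bij_betw_map_prod[OF bij(2,1)] by (simp add: map_prod_def)
  ultimately have iso: "semidirect H G \<mu> \<cong> semidirect H0 G0 \<nu>"
    by (intro is_isoI[of "\<lambda>(x, s). (h x, g s)"]) (simp add: iso_def)
  obtain K :: "nat monoid" and k where K: "group K" "k \<in> iso (semidirect H G \<mu>) K"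
    by (rule nat_copy[OF grp]) (simp add: A'_group_finite_group(2)[OF G] H(2))
  then have "K \<cong> semidirect H0 G0 \<nu>"
    using iso iso_trans group.iso_sym[OF grp] is_isoI by blast
  moreover have "order H0 = order H" "order G0 = order G" "finite (carrier H0)"
    using bij H(2) by (auto simp: order_def bij_betw_same_card[symmetric] bij_betw_finite)
  ultimately have "A'_nat K"
    using A'_nat.semidirect[OF G0(1) cH0 _ _ nu K(1)] cop by simp
  then show ?thesis
    using grp K is_isoI unfolding A'_group_def by blast
qed


section \<open>The groups of the construction\<close>

text \<open>The additive and multiplicative groups of a field \<open>F\<close> are \<^term>\<open>add_monoid F\<close> and
  \<^term>\<open>Multiplicative_Group.mult_of F\<close>, and \<^term>\<open>integer_mod_group n\<close> is the cyclic group with \<open>n > 0\<close> elements.\<close>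

definition scaling_action :: "('a, 'm) ring_scheme \<Rightarrow> ('c \<Rightarrow> 'a) \<Rightarrow> 'c \<Rightarrow> 'a \<Rightarrow> 'a" where
  "scaling_action F \<phi> s = (\<lambda>x\<in>carrier F. \<phi> s \<otimes>\<^bsub>F\<^esub> x)"

definition affine_group ::
    "('a, 'm) ring_scheme \<Rightarrow> ('c, 'n) monoid_scheme \<Rightarrow> ('c \<Rightarrow> 'a) \<Rightarrow> ('a \<times> 'c) monoid" where
  "affine_group F C \<phi> = semidirect (add_monoid F) C (scaling_action F \<phi>)"

text \<open>An element \<open>t\<close> multiplies the field components by \<open>\<rho>\<^sub>1 t\<close> and \<open>\<rho>\<^sub>2 t\<close> and fixes the components
  in \<open>C\<close> and \<open>D\<close>; \<open>affine_pair_action_hom\<close> confirms that this is an action by automorphisms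
  of \<open>affine_group F C \<phi> \<times>\<times> affine_group E D \<psi>\<close>.\<close>

definition affine_pair_action ::
    "('a, 'm) ring_scheme \<Rightarrow> ('c, 'n) monoid_scheme \<Rightarrow> ('e \<Rightarrow> 'a) \<Rightarrow>
     ('b, 'k) ring_scheme \<Rightarrow> ('d, 'l) monoid_scheme \<Rightarrow> ('e \<Rightarrow> 'b) \<Rightarrow>
     'e \<Rightarrow> ('a \<times> 'c) \<times> ('b \<times> 'd) \<Rightarrow> ('a \<times> 'c) \<times> ('b \<times> 'd)" where
  "affine_pair_action F C \<rho>\<^sub>1 E D \<rho>\<^sub>2 t =
    (\<lambda>((x, c), (y, d))\<in>(carrier F \<times> carrier C) \<times> (carrier E \<times> carrier D).
      ((\<rho>\<^sub>1 t \<otimes>\<^bsub>F\<^esub> x, c), (\<rho>\<^sub>2 t \<otimes>\<^bsub>E\<^esub> y, d)))"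


lemma scaling_action_hom:
  assumes "field F" "group C" and "\<phi> \<in> hom C (Multiplicative_Group.mult_of F)"
  shows "scaling_action F \<phi> \<in> hom C (AutoGroup (add_monoid F))"
proof -
  interpret F: field F by fact
  interpret C: group C by fact
  have nz: "\<phi> s \<in> carrier F - {\<zero>\<^bsub>F\<^esub>}" if "s \<in> carrier C" for s
    using assms(3) that by (auto simp: hom_def)
  have "bij_betw (scaling_action F \<phi> s) (carrier F) (carrier F)" if s: "s \<in> carrier C" for s
  proof -
    have "\<phi> s \<in> Units F"
      using nz[OF s] F.field_Units by simp
    then show ?thesis
      using nz[OF s] unfolding scaling_action_def
      by (intro bij_betwI[where g = "\<lambda>x. inv\<^bsub>F\<^esub> (\<phi> s) \<otimes>\<^bsub>F\<^esub> x"])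
        (auto simp flip: F.m_assoc)
  qed
  moreover have "\<phi> (s \<otimes>\<^bsub>C\<^esub> t) = \<phi> s \<otimes>\<^bsub>F\<^esub> \<phi> t" if "s \<in> carrier C" "t \<in> carrier C" for s t
    using assms(3) that by (auto simp: hom_def)
  ultimately show ?thesis
    using nz unfolding hom_AutoGroup_iff[OF F.a_group C.is_group]
    by (auto simp: scaling_action_def F.r_distr F.m_assoc)
qed

lemma group_affine_group:
  assumes "field F" "group C" and "\<phi> \<in> hom C (Multiplicative_Group.mult_of F)"
  shows "group (affine_group F C \<phi>)"
proof -
  interpret F: field F by fact
  show ?thesis
    using group_semidirect[OF F.a_group assms(2) scaling_action_hom[OF assms]]
    by (simp add: affine_group_def)
qed

lemma affine_pair_action_hom:
  assumes F: "field F" "group C" "\<phi> \<in> hom C (Multiplicative_Group.mult_of F)"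
    and E: "field E" "group D" "\<psi> \<in> hom D (Multiplicative_Group.mult_of E)"
    and R: "group R" "\<rho>\<^sub>1 \<in> hom R (Multiplicative_Group.mult_of F)" "\<rho>\<^sub>2 \<in> hom R (Multiplicative_Group.mult_of E)"
  shows "affine_pair_action F C \<rho>\<^sub>1 E D \<rho>\<^sub>2
    \<in> hom R (AutoGroup (affine_group F C \<phi> \<times>\<times> affine_group E D \<psi>))"
proof -
  interpret F: field F by fact
  interpret E: field E by fact
  interpret C: group C by fact
  interpret D: group D by fact
  interpret R: group R by fact
  have grp: "group (affine_group F C \<phi> \<times>\<times> affine_group E D \<psi>)"
    by (intro DirProd_group group_affine_group assms)
  have cF: "\<And>c. c \<in> carrier C \<Longrightarrow> \<phi> c \<in> carrier F" "\<And>t. t \<in> carrier R \<Longrightarrow> \<rho>\<^sub>1 t \<in> carrier F"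
    and cE: "\<And>d. d \<in> carrier D \<Longrightarrow> \<psi> d \<in> carrier E" "\<And>t. t \<in> carrier R \<Longrightarrow> \<rho>\<^sub>2 t \<in> carrier E"
    and hom: "\<And>s t. \<lbrakk>s \<in> carrier R; t \<in> carrier R\<rbrakk> \<Longrightarrow> \<rho>\<^sub>1 (s \<otimes>\<^bsub>R\<^esub> t) = \<rho>\<^sub>1 s \<otimes>\<^bsub>F\<^esub> \<rho>\<^sub>1 t"
      "\<And>s t. \<lbrakk>s \<in> carrier R; t \<in> carrier R\<rbrakk> \<Longrightarrow> \<rho>\<^sub>2 (s \<otimes>\<^bsub>R\<^esub> t) = \<rho>\<^sub>2 s \<otimes>\<^bsub>E\<^esub> \<rho>\<^sub>2 t"
    and U: "\<And>t. t \<in> carrier R \<Longrightarrow> \<rho>\<^sub>1 t \<in> Units F" "\<And>t. t \<in> carrier R \<Longrightarrow> \<rho>\<^sub>2 t \<in> Units E"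
    using F(3) E(3) R(2,3) by (auto simp: hom_def F.field_Units E.field_Units)
  have car: "carrier (affine_group F C \<phi> \<times>\<times> affine_group E D \<psi>)
      = (carrier F \<times> carrier C) \<times> (carrier E \<times> carrier D)"
    by (simp add: affine_group_def DirProd_def)
  have "bij_betw (affine_pair_action F C \<rho>\<^sub>1 E D \<rho>\<^sub>2 t)
      ((carrier F \<times> carrier C) \<times> (carrier E \<times> carrier D))
      ((carrier F \<times> carrier C) \<times> (carrier E \<times> carrier D))" if t: "t \<in> carrier R" for t
  proof -
    have "\<And>x. x \<in> carrier F \<Longrightarrow> inv\<^bsub>F\<^esub> (\<rho>\<^sub>1 t) \<otimes>\<^bsub>F\<^esub> (\<rho>\<^sub>1 t \<otimes>\<^bsub>F\<^esub> x) = x"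
      "\<And>x. x \<in> carrier F \<Longrightarrow> \<rho>\<^sub>1 t \<otimes>\<^bsub>F\<^esub> (inv\<^bsub>F\<^esub> (\<rho>\<^sub>1 t) \<otimes>\<^bsub>F\<^esub> x) = x"
      using U(1)[OF t] cF(2)[OF t] by (simp_all flip: F.m_assoc)
    moreover have "\<And>y. y \<in> carrier E \<Longrightarrow> inv\<^bsub>E\<^esub> (\<rho>\<^sub>2 t) \<otimes>\<^bsub>E\<^esub> (\<rho>\<^sub>2 t \<otimes>\<^bsub>E\<^esub> y) = y"
      "\<And>y. y \<in> carrier E \<Longrightarrow> \<rho>\<^sub>2 t \<otimes>\<^bsub>E\<^esub> (inv\<^bsub>E\<^esub> (\<rho>\<^sub>2 t) \<otimes>\<^bsub>E\<^esub> y) = y"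
      using U(2)[OF t] cE(2)[OF t] by (simp_all flip: E.m_assoc)
    moreover have "inv\<^bsub>F\<^esub> (\<rho>\<^sub>1 t) \<in> carrier F" "inv\<^bsub>E\<^esub> (\<rho>\<^sub>2 t) \<in> carrier E"
      using U[OF t] by simp_all
    ultimately show ?thesis
      using cF(2)[OF t] cE(2)[OF t] unfolding affine_pair_action_def
      by (intro bij_betwI[where g = "\<lambda>((x, c), (y, d)).
            ((inv\<^bsub>F\<^esub> (\<rho>\<^sub>1 t) \<otimes>\<^bsub>F\<^esub> x, c), (inv\<^bsub>E\<^esub> (\<rho>\<^sub>2 t) \<otimes>\<^bsub>E\<^esub> y, d))"]) auto
  qed
  note bij = this
  let ?A = "affine_pair_action F C \<rho>\<^sub>1 E D \<rho>\<^sub>2"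
  have app: "?A t ((x, c), (y, d)) = ((\<rho>\<^sub>1 t \<otimes>\<^bsub>F\<^esub> x, c), (\<rho>\<^sub>2 t \<otimes>\<^bsub>E\<^esub> y, d))"
    if "x \<in> carrier F" "c \<in> carrier C" "y \<in> carrier E" "d \<in> carrier D" for t x c y d
    using that by (simp add: affine_pair_action_def)
  have mult: "(x, c) \<otimes>\<^bsub>affine_group F C \<phi>\<^esub> (x', c') = (x \<oplus>\<^bsub>F\<^esub> \<phi> c \<otimes>\<^bsub>F\<^esub> x', c \<otimes>\<^bsub>C\<^esub> c')"
    if "x' \<in> carrier F" for x c x' c'
    using that by (simp add: affine_group_def scaling_action_def)
  have mult2: "(y, d) \<otimes>\<^bsub>affine_group E D \<psi>\<^esub> (y', d') = (y \<oplus>\<^bsub>E\<^esub> \<psi> d \<otimes>\<^bsub>E\<^esub> y', d \<otimes>\<^bsub>D\<^esub> d')"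
    if "y' \<in> carrier E" for y d y' d'
    using that by (simp add: affine_group_def scaling_action_def)
  have "?A t (u \<otimes>\<^bsub>affine_group F C \<phi> \<times>\<times> affine_group E D \<psi>\<^esub> v)
      = ?A t u \<otimes>\<^bsub>affine_group F C \<phi> \<times>\<times> affine_group E D \<psi>\<^esub> ?A t v"
    if t: "t \<in> carrier R" and u: "u \<in> (carrier F \<times> carrier C) \<times> (carrier E \<times> carrier D)"
      and v: "v \<in> (carrier F \<times> carrier C) \<times> (carrier E \<times> carrier D)" for t u v
  proof -
    obtain x c y d x' c' y' d' where uv: "u = ((x, c), (y, d))" "v = ((x', c'), (y', d'))"
      by (metis surj_pair)
    have car: "x \<in> carrier F" "c \<in> carrier C" "y \<in> carrier E" "d \<in> carrier D"
      "x' \<in> carrier F" "c' \<in> carrier C" "y' \<in> carrier E" "d' \<in> carrier D"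
      using u v uv by auto
    have "\<rho>\<^sub>1 t \<otimes>\<^bsub>F\<^esub> (x \<oplus>\<^bsub>F\<^esub> \<phi> c \<otimes>\<^bsub>F\<^esub> x')
        = \<rho>\<^sub>1 t \<otimes>\<^bsub>F\<^esub> x \<oplus>\<^bsub>F\<^esub> \<phi> c \<otimes>\<^bsub>F\<^esub> (\<rho>\<^sub>1 t \<otimes>\<^bsub>F\<^esub> x')"
      using car t cF by (simp add: F.r_distr F.m_lcomm)
    moreover have "\<rho>\<^sub>2 t \<otimes>\<^bsub>E\<^esub> (y \<oplus>\<^bsub>E\<^esub> \<psi> d \<otimes>\<^bsub>E\<^esub> y')
        = \<rho>\<^sub>2 t \<otimes>\<^bsub>E\<^esub> y \<oplus>\<^bsub>E\<^esub> \<psi> d \<otimes>\<^bsub>E\<^esub> (\<rho>\<^sub>2 t \<otimes>\<^bsub>E\<^esub> y')"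
      using car t cE by (simp add: E.r_distr E.m_lcomm)
    ultimately show ?thesis
      using car cF cE t by (simp add: uv mult mult2 app)
  qed
  moreover have "?A (s \<otimes>\<^bsub>R\<^esub> t) u = ?A s (?A t u)"
    if "s \<in> carrier R" "t \<in> carrier R"
      "u \<in> (carrier F \<times> carrier C) \<times> (carrier E \<times> carrier D)" for s t u
    using that cF cE by (auto simp: app hom F.m_assoc E.m_assoc)
  moreover have "?A t \<in> extensional ((carrier F \<times> carrier C) \<times> (carrier E \<times> carrier D))" for t
    by (simp add: affine_pair_action_def)
  ultimately show ?thesis
    unfolding hom_AutoGroup_iff[OF grp R.is_group] car by (intro conjI ballI bij)
qed

end

theory Submission
  imports Defs
begin

text \<open>
  Throughout, \<open>G\<close> is viewed as an extension of the abelian group \<open>C\<^sub>q \<times> C\<^sub>p \<times> C\<^sub>r\<close> by the abelian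
  normal subgroup \<open>F \<times> E\<close>, where \<open>(c, d, t)\<close> multiplies \<open>F\<close> by the scalar \<open>\<chi>\<^sub>1 c t = \<phi> c \<rho>\<^sub>1 t\<close>
  and \<open>E\<close> by the scalar \<open>\<chi>\<^sub>2 d t = \<psi> d \<rho>\<^sub>2 t\<close>. Thus \<open>G\<close> is metabelian. Since the orders of the
  cyclic factors are coprime and the given homomorphisms are injective, each scalar equals \<open>1\<close> only
  if both its arguments are trivial.

  Every Sylow subgroup \<open>P\<close> of \<open>G\<close> is abelian: a commutator of elements of \<open>P\<close> lies in \<open>F \<times> E\<close>,
  and if \<open>P\<close> is an \<open>l\<close>-group, its component in \<open>F\<close> vanishes for order reasons when \<open>l \<noteq> p\<close>, while
  for \<open>l = p\<close> the components of \<open>P\<close> in \<open>C\<^sub>q\<close> and \<open>C\<^sub>r\<close> are trivial, so \<open>P\<close> acts trivially on \<open>F\<close>;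
  the component in \<open>E\<close> is treated in the same way.

  That \<open>G\<close> is not an \<open>A'\<close>-group follows from an obstruction with two parts
  (\<open>not_A'_nat_if_iso\<close>). For every prime \<open>l\<close> dividing the order of \<open>G\<close> there are \<open>g\<close> with
  \<open>g\<^sup>l = 1\<close> and \<open>y\<close> such that \<open>g\<close> does not commute with \<open>[g, y]\<close>
  (\<open>noncommuting_commutator_prime\<close>). This rules out a nontrivial abelian normal Hall subgroup \<open>H\<close>:
  it would contain all elements of order \<open>l\<close> for a prime divisor \<open>l\<close> of its order, hence \<open>g\<close> and
  \<open>[g, y]\<close>. Next, for a generator \<open>t\<close> of \<open>C\<^sub>r\<close>, only the identity has all its conjugates in the
  centraliser of \<open>t\<close> (\<open>centraliser_core_trivial\<close>), and \<open>r\<close> divides the order of \<open>G\<close> only once.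
  This rules out a proper direct decomposition \<open>G\<^sub>1 \<times> G\<^sub>2\<close>: the order of one factor is prime to
  \<open>r\<close>, so \<open>t\<close> lies in the other factor and is centralised by the normal subgroup formed by the
  first. Hence in a construction of \<open>G\<close> as an \<open>A'\<close>-group every step is trivial, and the
  remaining case, that \<open>G\<close> is abelian, is impossible.
\<close>

section \<open>Elements of finite groups\<close>

lemma (in group) eq_one_if_pow_coprime:
  assumes "x \<in> carrier G" "x [^] (n::nat) = \<one>" "coprime n (order G)"
  shows "x = \<one>"
proof -
  have "ord x dvd n" "ord x dvd order G"
    using assms pow_eq_id ord_dvd_group_order by auto
  then have "ord x = 1"
    using assms(3) coprime_common_divisor_nat by blast
  then show ?thesis
    using assms(1) pow_ord_eq_1 by fastforce
qed

lemma (in group) ex_non_one_if_prime_order: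
  assumes "Factorial_Ring.prime (order G)"
  shows "\<exists>x\<in>carrier G. x \<noteq> \<one>"
proof -
  have "order G \<noteq> 1"
    using assms by auto
  then show ?thesis
    using order_one_triv_iff one_closed by blast
qed

section \<open>An obstruction to being an A'-group\<close>

text \<open>The hypothesis on \<open>t\<close> says that the centraliser of \<open>t\<close> has trivial normal core; the conjugate
  \<open>g b g\<inverse>\<close> is described by the equation \<open>b' g = g b\<close>, which a homomorphism visibly preserves.
  Elements of \<open>{1} \<times> G2\<close> have all their conjugates in the centraliser of \<open>h t \<in> G1 \<times> {1}\<close>, so
  \<open>G2\<close> is trivial.\<close>

lemma DirProd_iso_factor:
  assumes G: "group G" and G1: "group G1" and G2: "group G2" and h: "h \<in> iso G (G1 \<times>\<times> G2)"
    and t: "t \<in> carrier G" "snd (h t) = \<one>\<^bsub>G2\<^esub>"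
    and cent: "\<And>b. \<lbrakk>b \<in> carrier G;
      \<And>g b'. \<lbrakk>g \<in> carrier G; b' \<in> carrier G; b' \<otimes>\<^bsub>G\<^esub> g = g \<otimes>\<^bsub>G\<^esub> b\<rbrakk> \<Longrightarrow> b' \<otimes>\<^bsub>G\<^esub> t = t \<otimes>\<^bsub>G\<^esub> b'\<rbrakk>
      \<Longrightarrow> b = \<one>\<^bsub>G\<^esub>"
  shows "fst \<circ> h \<in> iso G G1"
proof -
  interpret G: group G by fact
  interpret G1: group G1 by fact
  interpret G2: group G2 by fact
  have bij: "bij_betw h (carrier G) (carrier G1 \<times> carrier G2)"
    using h by (simp add: iso_def)
  have cl: "fst (h x) \<in> carrier G1" "snd (h x) \<in> carrier G2" if "x \<in> carrier G" for x
    using bij_betwE[OF bij] that by (auto simp: mem_Times_iff)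
  have mult: "fst (h (x \<otimes>\<^bsub>G\<^esub> y)) = fst (h x) \<otimes>\<^bsub>G1\<^esub> fst (h y)"
    "snd (h (x \<otimes>\<^bsub>G\<^esub> y)) = snd (h x) \<otimes>\<^bsub>G2\<^esub> snd (h y)"
    if "x \<in> carrier G" "y \<in> carrier G" for x y
  proof -
    have "h (x \<otimes>\<^bsub>G\<^esub> y) = h x \<otimes>\<^bsub>G1 \<times>\<times> G2\<^esub> h y"
      using h that by (simp add: iso_def hom_def)
    then show "fst (h (x \<otimes>\<^bsub>G\<^esub> y)) = fst (h x) \<otimes>\<^bsub>G1\<^esub> fst (h y)"
      "snd (h (x \<otimes>\<^bsub>G\<^esub> y)) = snd (h x) \<otimes>\<^bsub>G2\<^esub> snd (h y)"
      by (simp_all add: mult_DirProd' case_prod_beta)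
  qed
  have one: "x = \<one>\<^bsub>G\<^esub>" if x: "x \<in> carrier G" "fst (h x) = \<one>\<^bsub>G1\<^esub>" for x
  proof (rule cent[OF x(1)])
    fix g x' assume g: "g \<in> carrier G" "x' \<in> carrier G" "x' \<otimes>\<^bsub>G\<^esub> g = g \<otimes>\<^bsub>G\<^esub> x"
    have "fst (h x') \<otimes>\<^bsub>G1\<^esub> fst (h g) = fst (h g)"
      using mult(1)[of x' g] mult(1)[of g x] g x cl by simp
    then have "fst (h x') = \<one>\<^bsub>G1\<^esub>"
      using cl g by (metis G1.r_cancel_one')
    then have "h (x' \<otimes>\<^bsub>G\<^esub> t) = h (t \<otimes>\<^bsub>G\<^esub> x')"
      using mult cl t g by (intro prod_eqI) simp_all
    then show "x' \<otimes>\<^bsub>G\<^esub> t = t \<otimes>\<^bsub>G\<^esub> x'"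
      using bij t g by (meson G.m_closed bij_betw_def inj_onD)
  qed
  have hom: "fst \<circ> h \<in> hom G G1"
    using cl mult by (auto intro!: homI)
  interpret f: group_hom G G1 "fst \<circ> h"
    using hom by unfold_locales
  have "inj_on (fst \<circ> h) (carrier G)"
    using one by (auto simp: f.inj_on_one_iff)
  moreover have "(fst \<circ> h) ` carrier G = carrier G1"
    unfolding image_comp[symmetric] bij_betw_imp_surj_on[OF bij] using G2.one_closed by force
  ultimately show ?thesis
    using hom by (simp add: iso_def bij_betw_def)
qed

text \<open>In hypothesis \<open>act\<close>, the equation \<open>g y = z y g\<close> says that \<open>z\<close> is the commutator of \<open>g\<close> and
  \<open>y\<close>. The induction keeps \<open>G\<close> fixed and shows that no group of the class is isomorphic to it: in
  the semidirect and product cases the obstruction forces one factor to be trivial, which makes the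
  other one isomorphic to \<open>G\<close>.\<close>

lemma not_A'_nat_if_iso:
  assumes "A'_nat K" and "h \<in> iso G K" and G: "group G"
    and act: "\<And>l. \<lbrakk>Factorial_Ring.prime l; l dvd order G\<rbrakk> \<Longrightarrow>
      \<exists>g\<in>carrier G. \<exists>y\<in>carrier G. \<exists>z\<in>carrier G. g [^]\<^bsub>G\<^esub> l = \<one>\<^bsub>G\<^esub>
        \<and> g \<otimes>\<^bsub>G\<^esub> y = z \<otimes>\<^bsub>G\<^esub> (y \<otimes>\<^bsub>G\<^esub> g) \<and> g \<otimes>\<^bsub>G\<^esub> z \<noteq> z \<otimes>\<^bsub>G\<^esub> g"
    and r: "Factorial_Ring.prime r" "r dvd order G" "\<not> r * r dvd order G"
    and t: "t \<in> carrier G" "t [^]\<^bsub>G\<^esub> r = \<one>\<^bsub>G\<^esub>"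
    and cent: "\<And>b. \<lbrakk>b \<in> carrier G;
      \<And>g b'. \<lbrakk>g \<in> carrier G; b' \<in> carrier G; b' \<otimes>\<^bsub>G\<^esub> g = g \<otimes>\<^bsub>G\<^esub> b\<rbrakk> \<Longrightarrow> b' \<otimes>\<^bsub>G\<^esub> t = t \<otimes>\<^bsub>G\<^esub> b'\<rbrakk>
      \<Longrightarrow> b = \<one>\<^bsub>G\<^esub>"
  shows False
  using assms(1,2)
proof (induction arbitrary: h rule: A'_nat.induct)
  case (abelian K)
  interpret G: group G by fact
  interpret K: comm_group K by fact
  have h: "h \<in> hom G K" "inj_on h (carrier G)"
    using abelian(3) by (auto simp: iso_def bij_betw_def)
  obtain g z where "g \<in> carrier G" "z \<in> carrier G" "g \<otimes>\<^bsub>G\<^esub> z \<noteq> z \<otimes>\<^bsub>G\<^esub> g"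
    using act[OF r(1,2)] by blast
  moreover from this have "h (g \<otimes>\<^bsub>G\<^esub> z) = h (z \<otimes>\<^bsub>G\<^esub> g)"
    using h(1) by (simp add: hom_mult hom_in_carrier K.m_comm)
  ultimately show False
    using h(2) by (meson G.m_closed inj_onD)
next
  case (semidirect Q H \<mu> K)
  interpret G: group G by fact
  interpret Q: group Q using A'_nat_finite_group semidirect(1) by blast
  interpret H: comm_group H by fact
  note mu = semidirect(5)[unfolded hom_AutoGroup_iff[OF H.is_group Q.is_group]]
  have mcl: "\<mu> s x \<in> carrier H" if "s \<in> carrier Q" "x \<in> carrier H" for s x
    using mu that bij_betwE by blast
  have mu1: "\<mu> \<one>\<^bsub>Q\<^esub> x = x" if x: "x \<in> carrier H" for x
  proof -
    have "\<mu> \<one>\<^bsub>Q\<^esub> (\<mu> \<one>\<^bsub>Q\<^esub> x) = \<mu> \<one>\<^bsub>Q\<^esub> x"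
      using mu x by (metis Q.l_one Q.one_closed)
    moreover have "inj_on (\<mu> \<one>\<^bsub>Q\<^esub>) (carrier H)"
      using mu by (auto simp: bij_betw_def)
    ultimately show ?thesis
      using x mcl by (auto dest: inj_onD)
  qed
  obtain k where k: "k \<in> iso K (semidirect H Q \<mu>)"
    using semidirect(7) by (auto simp: is_iso_def)
  define f where "f = k \<circ> h"
  have f: "f \<in> iso G (semidirect H Q \<mu>)"
    using iso_set_trans[OF semidirect.prems k] by (simp add: f_def)
  then have bij: "bij_betw f (carrier G) (carrier H \<times> carrier Q)"
    by (simp add: iso_def)
  have cl: "fst (f x) \<in> carrier H" "snd (f x) \<in> carrier Q" if "x \<in> carrier G" for x
    using bij_betwE[OF bij] that by (auto simp: mem_Times_iff)
  have mult: "f (x \<otimes>\<^bsub>G\<^esub> y)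
      = (fst (f x) \<otimes>\<^bsub>H\<^esub> \<mu> (snd (f x)) (fst (f y)), snd (f x) \<otimes>\<^bsub>Q\<^esub> snd (f y))"
    if "x \<in> carrier G" "y \<in> carrier G" for x y
    using f that by (simp add: iso_def hom_def semidirect_def case_prod_beta)
  have hom: "snd \<circ> f \<in> hom G Q"
    using cl by (auto intro!: homI simp: mult)
  interpret f: group_hom G Q "snd \<circ> f"
    using hom by unfold_locales
  show False
  proof (cases "order H = 1")
    case True
    then have H1: "carrier H = {\<one>\<^bsub>H\<^esub>}"
      using H.order_one_triv_iff by auto
    then have "inj_on (snd \<circ> f) (carrier G)"
      using bij cl(1) by (intro inj_onI) (metis comp_apply bij_betw_def inj_onD prod_eqI singletonD)
    moreover have "(snd \<circ> f) ` carrier G = carrier Q"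
      unfolding image_comp[symmetric] bij_betw_imp_surj_on[OF bij] H1 by force
    ultimately have "snd \<circ> f \<in> iso G Q"
      using hom by (simp add: iso_def bij_betw_def)
    then show False
      by (rule semidirect.IH)
  next
    case False
    then obtain l where l: "Factorial_Ring.prime l" "l dvd order H"
      using prime_factor_nat by blast
    have "order G = order H * order Q"
      using bij_betw_same_card[OF bij] by (simp add: order_def card_cartesian_product)
    then obtain g y z where gyz: "g \<in> carrier G" "y \<in> carrier G" "z \<in> carrier G"
        "g [^]\<^bsub>G\<^esub> l = \<one>\<^bsub>G\<^esub>" "g \<otimes>\<^bsub>G\<^esub> y = z \<otimes>\<^bsub>G\<^esub> (y \<otimes>\<^bsub>G\<^esub> g)" "g \<otimes>\<^bsub>G\<^esub> z \<noteq> z \<otimes>\<^bsub>G\<^esub> g"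
      using act[OF l(1)] l(2) by (metis dvd_mult2)
    \<comment> \<open>Modulo the Hall subgroup \<open>H\<close> the element \<open>g\<close> becomes trivial, and hence so does \<open>z = [g, y]\<close>.\<close>
    have "coprime l (order Q)"
      using coprime_divisors[OF l(2) dvd_refl semidirect(4)] .
    moreover have "snd (f g) [^]\<^bsub>Q\<^esub> l = \<one>\<^bsub>Q\<^esub>"
      using f.hom_nat_pow[OF gyz(1), of l] gyz(4) f.hom_one by simp
    ultimately have sg: "snd (f g) = \<one>\<^bsub>Q\<^esub>"
      using Q.eq_one_if_pow_coprime cl gyz(1) by blast
    have "snd (f g) \<otimes>\<^bsub>Q\<^esub> snd (f y) = snd (f z) \<otimes>\<^bsub>Q\<^esub> (snd (f y) \<otimes>\<^bsub>Q\<^esub> snd (f g))"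
      using arg_cong[OF gyz(5), of "snd \<circ> f"] gyz(1-3) by (simp add: mult)
    then have "snd (f y) = snd (f z) \<otimes>\<^bsub>Q\<^esub> snd (f y)"
      using sg cl(2) gyz(2) by simp
    then have sz: "snd (f z) = \<one>\<^bsub>Q\<^esub>"
      using Q.r_cancel_one'[OF cl(2) cl(2), OF gyz(2,3)] by simp
    have "f (g \<otimes>\<^bsub>G\<^esub> z) = f (z \<otimes>\<^bsub>G\<^esub> g)"
      using sg sz cl gyz(1-3) by (simp add: mult mu1 H.m_comm)
    then show False
      using gyz bij by (meson G.m_closed bij_betw_def inj_onD)
  qed
next
  case (product G1 G2 K)
  interpret G: group G by fact
  interpret G1: group G1 using A'_nat_finite_group product(1) by blast
  interpret G2: group G2 using A'_nat_finite_group product(2) by blast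
  obtain k where k: "k \<in> iso K (G1 \<times>\<times> G2)"
    using product.hyps(4) by (auto simp: is_iso_def)
  define f where "f = k \<circ> h"
  have f: "f \<in> iso G (G1 \<times>\<times> G2)"
    using iso_set_trans[OF product.prems k] by (simp add: f_def)
  define f' where "f' = (\<lambda>(x, y). (y, x)) \<circ> f"
  have f': "f' \<in> iso G (G2 \<times>\<times> G1)"
    using iso_set_trans[OF f DirProd_commute_iso_set] by (simp add: f'_def)
  have ord: "order G = order G1 * order G2"
    using f by (auto simp: iso_def order_def card_cartesian_product dest!: bij_betw_same_card)
  have hom: "f \<in> hom G (G1 \<times>\<times> G2)"
    using f by (simp add: iso_def)
  have hom1: "fst \<circ> f \<in> hom G G1" and hom2: "snd \<circ> f \<in> hom G G2"
    using hom by (auto simp: hom_def Pi_iff mem_Times_iff mult_DirProd' case_prod_beta)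
  interpret f1: group_hom G G1 "fst \<circ> f"
    using hom1 by unfold_locales
  interpret f2: group_hom G G2 "snd \<circ> f"
    using hom2 by unfold_locales
  consider "\<not> r dvd order G1" | "\<not> r dvd order G2"
    using r(3) mult_dvd_mono unfolding ord by blast
  then show False
  proof cases
    case 1
    then have "coprime r (order G1)"
      using r(1) prime_imp_coprime by blast
    moreover have "fst (f t) [^]\<^bsub>G1\<^esub> r = \<one>\<^bsub>G1\<^esub>"
      using f1.hom_nat_pow[OF t(1), of r] t(2) f1.hom_one by simp
    ultimately have "fst (f t) = \<one>\<^bsub>G1\<^esub>"
      using G1.eq_one_if_pow_coprime f1.hom_closed[OF t(1)] by simp
    then have "snd (f' t) = \<one>\<^bsub>G1\<^esub>"
      by (simp add: f'_def case_prod_beta)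
    then show False
      using DirProd_iso_factor[OF G G2.is_group G1.is_group f' t(1) _ cent] product.IH(2)
      by blast
  next
    case 2
    then have "coprime r (order G2)"
      using r(1) prime_imp_coprime by blast
    moreover have "snd (f t) [^]\<^bsub>G2\<^esub> r = \<one>\<^bsub>G2\<^esub>"
      using f2.hom_nat_pow[OF t(1), of r] t(2) f2.hom_one by simp
    ultimately have "snd (f t) = \<one>\<^bsub>G2\<^esub>"
      using G2.eq_one_if_pow_coprime f2.hom_closed[OF t(1)] by simp
    then show False
      using DirProd_iso_factor[OF G G1.is_group G2.is_group f t(1) _ cent] product.IH(1)
      by blast
  qed
qed


section \<open>Scalars in a field\<close>

lemma (in field) comm_group_mult_of: "comm_group (Multiplicative_Group.mult_of R)"
  using units_comm_group by (simp add: mult_of_is_Units)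

lemma (in domain) scaling_fixed_eq_zero:
  assumes "k \<in> carrier R" "x \<in> carrier R" "k \<otimes> x = x" "k \<noteq> \<one>"
  shows "x = \<zero>"
  using assms m_rcancel[of x k \<one>] by auto

text \<open>Raising \<open>f c \<otimes> g t = \<one>\<close> to the power \<open>order T\<close> eliminates \<open>t\<close>.\<close>

lemma (in comm_group) mon_mult_eq_one:
  assumes "group C" "group T" and f: "f \<in> mon C G" and g: "g \<in> mon T G"
    and cop: "coprime (order C) (order T)"
    and ct: "c \<in> carrier C" "t \<in> carrier T" "f c \<otimes> g t = \<one>"
  shows "c = \<one>\<^bsub>C\<^esub> \<and> t = \<one>\<^bsub>T\<^esub>"
proof -
  interpret C: group C by fact
  interpret T: group T by fact
  interpret f: group_hom C G f using f by unfold_locales (simp add: mon_def)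
  interpret g: group_hom T G g using g by unfold_locales (simp add: mon_def)
  have inj: "inj_on f (carrier C)" "inj_on g (carrier T)"
    using f g by (simp_all add: mon_def)
  have "g t [^] order T = \<one>"
    using g.hom_nat_pow[OF ct(2), of "order T"] T.pow_order_eq_1[OF ct(2)] by simp
  then have "f c [^] order T = (f c \<otimes> g t) [^] order T"
    using ct(1,2) by (simp add: pow_mult_distrib m_comm)
  then have "f (c [^]\<^bsub>C\<^esub> order T) = f \<one>\<^bsub>C\<^esub>"
    using ct by (simp add: f.hom_nat_pow)
  then have "c [^]\<^bsub>C\<^esub> order T = \<one>\<^bsub>C\<^esub>"
    using inj(1) ct by (meson C.nat_pow_closed C.one_closed inj_onD)
  then have c: "c = \<one>\<^bsub>C\<^esub>"
    using C.eq_one_if_pow_coprime[OF ct(1)] cop by (simp add: coprime_commute)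
  then have "g t = g \<one>\<^bsub>T\<^esub>"
    using ct by simp
  then show ?thesis
    using c inj(2) ct by (meson T.one_closed inj_onD)
qed

section \<open>The group as an extension of abelian groups\<close>

text \<open>The cyclic groups are replaced by arbitrary abelian groups \<open>C\<close>, \<open>D\<close>, \<open>T\<close> of prime orders
  \<open>q\<close>, \<open>p\<close>, \<open>r\<close>.\<close>

locale affine_pair =
  F: field F + E: field E + C: comm_group C + D: comm_group D + T: comm_group T
  for F :: "('a, 'm) ring_scheme" and E :: "('b, 'n) ring_scheme"
    and C :: "('c, 'k) monoid_scheme" and D :: "('d, 'l) monoid_scheme"
    and T :: "('e, 'o) monoid_scheme" +
  fixes \<phi> :: "'c \<Rightarrow> 'a" and \<psi> :: "'d \<Rightarrow> 'b" and \<rho>\<^sub>1 :: "'e \<Rightarrow> 'a" and \<rho>\<^sub>2 :: "'e \<Rightarrow> 'b"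
    and p q r a b :: nat
  assumes prime: "Factorial_Ring.prime p" "Factorial_Ring.prime q" "Factorial_Ring.prime r"
    and distinct: "p \<noteq> q" "p \<noteq> r" "q \<noteq> r"
    and ord: "order F = p ^ a" "order E = q ^ b" "order C = q" "order D = p" "order T = r"
    and mon: "\<phi> \<in> mon C (Multiplicative_Group.mult_of F)"
      "\<psi> \<in> mon D (Multiplicative_Group.mult_of E)"
      "\<rho>\<^sub>1 \<in> mon T (Multiplicative_Group.mult_of F)"
      "\<rho>\<^sub>2 \<in> mon T (Multiplicative_Group.mult_of E)"
begin

text \<open>The group of the theorem, for general \<open>C\<close>, \<open>D\<close>, \<open>T\<close>; its elements are the tuples
  \<open>(((x, c), (y, d)), t)\<close>.\<close>

definition G :: "((('a \<times> 'c) \<times> ('b \<times> 'd)) \<times> 'e) monoid" where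
  "G = semidirect (affine_group F C \<phi> \<times>\<times> affine_group E D \<psi>) T
    (affine_pair_action F C \<rho>\<^sub>1 E D \<rho>\<^sub>2)"

text \<open>The scalars by which \<open>(c, d, t)\<close> acts on the normal subgroups \<open>F\<close> and \<open>E\<close> of \<open>G\<close>.\<close>

definition \<chi>\<^sub>1 :: "'c \<Rightarrow> 'e \<Rightarrow> 'a" where "\<chi>\<^sub>1 c t = \<phi> c \<otimes>\<^bsub>F\<^esub> \<rho>\<^sub>1 t"

definition \<chi>\<^sub>2 :: "'d \<Rightarrow> 'e \<Rightarrow> 'b" where "\<chi>\<^sub>2 d t = \<psi> d \<otimes>\<^bsub>E\<^esub> \<rho>\<^sub>2 t"

lemma homs:
  "\<phi> \<in> hom C (Multiplicative_Group.mult_of F)" "\<psi> \<in> hom D (Multiplicative_Group.mult_of E)"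
  "\<rho>\<^sub>1 \<in> hom T (Multiplicative_Group.mult_of F)" "\<rho>\<^sub>2 \<in> hom T (Multiplicative_Group.mult_of E)"
  using mon by (simp_all add: mon_def)

lemma closed [simp]:
  "c \<in> carrier C \<Longrightarrow> \<phi> c \<in> carrier F" "d \<in> carrier D \<Longrightarrow> \<psi> d \<in> carrier E"
  "t \<in> carrier T \<Longrightarrow> \<rho>\<^sub>1 t \<in> carrier F" "t \<in> carrier T \<Longrightarrow> \<rho>\<^sub>2 t \<in> carrier E"
  using homs by (auto simp: hom_def)

lemma \<chi>_closed [simp]:
  "\<lbrakk>c \<in> carrier C; t \<in> carrier T\<rbrakk> \<Longrightarrow> \<chi>\<^sub>1 c t \<in> carrier F"
  "\<lbrakk>d \<in> carrier D; t \<in> carrier T\<rbrakk> \<Longrightarrow> \<chi>\<^sub>2 d t \<in> carrier E"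
  by (simp_all add: \<chi>\<^sub>1_def \<chi>\<^sub>2_def)

lemma \<chi>_one [simp]:
  "\<chi>\<^sub>1 \<one>\<^bsub>C\<^esub> \<one>\<^bsub>T\<^esub> = \<one>\<^bsub>F\<^esub>" "\<chi>\<^sub>2 \<one>\<^bsub>D\<^esub> \<one>\<^bsub>T\<^esub> = \<one>\<^bsub>E\<^esub>"
  using hom_one[OF homs(1) C.is_group F.field_mult_group] hom_one[OF homs(2) D.is_group E.field_mult_group]
    hom_one[OF homs(3) T.is_group F.field_mult_group] hom_one[OF homs(4) T.is_group E.field_mult_group]
  by (simp_all add: \<chi>\<^sub>1_def \<chi>\<^sub>2_def)

lemma coprime_orders:
  "coprime q r" "coprime p r" "coprime p q"
  using prime distinct primes_coprime by blast+

lemma \<chi>\<^sub>1_eq_one: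
  assumes "c \<in> carrier C" "t \<in> carrier T" "\<chi>\<^sub>1 c t = \<one>\<^bsub>F\<^esub>"
  shows "c = \<one>\<^bsub>C\<^esub> \<and> t = \<one>\<^bsub>T\<^esub>"
  using assms coprime_orders
  by (intro comm_group.mon_mult_eq_one[OF F.comm_group_mult_of C.is_group T.is_group mon(1,3)])
    (simp_all add: ord \<chi>\<^sub>1_def)

lemma \<chi>\<^sub>2_eq_one:
  assumes "d \<in> carrier D" "t \<in> carrier T" "\<chi>\<^sub>2 d t = \<one>\<^bsub>E\<^esub>"
  shows "d = \<one>\<^bsub>D\<^esub> \<and> t = \<one>\<^bsub>T\<^esub>"
  using assms coprime_orders
  by (intro comm_group.mon_mult_eq_one[OF E.comm_group_mult_of D.is_group T.is_group mon(2,4)])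
    (simp_all add: ord \<chi>\<^sub>2_def)

lemma carrier_G: "carrier G = ((carrier F \<times> carrier C) \<times> (carrier E \<times> carrier D)) \<times> carrier T"
  by (simp add: G_def affine_group_def DirProd_def)

lemma mem_G [simp]:
  "(((x, c), (y, d)), t) \<in> carrier G \<longleftrightarrow>
    x \<in> carrier F \<and> c \<in> carrier C \<and> y \<in> carrier E \<and> d \<in> carrier D \<and> t \<in> carrier T"
  by (auto simp: carrier_G)

lemma one_G: "\<one>\<^bsub>G\<^esub> = (((\<zero>\<^bsub>F\<^esub>, \<one>\<^bsub>C\<^esub>), (\<zero>\<^bsub>E\<^esub>, \<one>\<^bsub>D\<^esub>)), \<one>\<^bsub>T\<^esub>)"
  by (simp add: G_def affine_group_def)

lemma mult_G:
  assumes "(((x, c), (y, d)), t) \<in> carrier G" "(((x', c'), (y', d')), t') \<in> carrier G"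
  shows "(((x, c), (y, d)), t) \<otimes>\<^bsub>G\<^esub> (((x', c'), (y', d')), t')
    = (((x \<oplus>\<^bsub>F\<^esub> \<chi>\<^sub>1 c t \<otimes>\<^bsub>F\<^esub> x', c \<otimes>\<^bsub>C\<^esub> c'), (y \<oplus>\<^bsub>E\<^esub> \<chi>\<^sub>2 d t \<otimes>\<^bsub>E\<^esub> y', d \<otimes>\<^bsub>D\<^esub> d')), t \<otimes>\<^bsub>T\<^esub> t')"
  using assms
  by (simp add: G_def affine_group_def affine_pair_action_def scaling_action_def
      \<chi>\<^sub>1_def \<chi>\<^sub>2_def F.m_assoc E.m_assoc)

lemma group_G: "group G"
  unfolding G_def
  by (intro group_semidirect affine_pair_action_hom DirProd_group group_affine_group homs
      F.field_axioms E.field_axioms C.is_group D.is_group T.is_group)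

sublocale G: group G by (rule group_G)

lemma finite_carriers:
  "finite (carrier F)" "finite (carrier E)" "finite (carrier C)" "finite (carrier D)" "finite (carrier T)"
  using prime ord by (auto simp: order_def prime_gt_0_nat intro!: card_ge_0_finite)

lemma finite_G: "finite (carrier G)"
  by (simp add: carrier_G finite_carriers)

lemma order_G: "order G = ((p ^ a * q) * (q ^ b * p)) * r"
  using ord by (simp add: order_def carrier_G card_cartesian_product)

lemma prime_dvd_order_base:
  assumes l: "Factorial_Ring.prime l" "l dvd (p ^ a * q) * (q ^ b * p)"
  shows "l = p \<or> l = q"
proof -
  have "l dvd p \<or> l dvd q"
    using l(2) prime_dvd_power[OF l(1)] unfolding prime_dvd_mult_iff[OF l(1)] by blast
  then show ?thesis
    using primes_dvd_imp_eq[OF l(1)] prime by blast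
qed

lemma projections:
  "(\<lambda>(((x, c), (y, d)), t). (c, d, t)) \<in> hom G (C \<times>\<times> (D \<times>\<times> T))"
  by (auto simp: hom_def carrier_G mult_G)

lemma pow_G_components:
  assumes "(((x, c), (y, d)), t) \<in> carrier G"
    and "(((x, c), (y, d)), t) [^]\<^bsub>G\<^esub> (n::nat) = \<one>\<^bsub>G\<^esub>"
  shows "c [^]\<^bsub>C\<^esub> n = \<one>\<^bsub>C\<^esub>" "d [^]\<^bsub>D\<^esub> n = \<one>\<^bsub>D\<^esub>" "t [^]\<^bsub>T\<^esub> n = \<one>\<^bsub>T\<^esub>"
proof -
  have "\<exists>x' y'. x' \<in> carrier F \<and> y' \<in> carrier E \<and> (((x, c), (y, d)), t) [^]\<^bsub>G\<^esub> n
      = (((x', c [^]\<^bsub>C\<^esub> n), (y', d [^]\<^bsub>D\<^esub> n)), t [^]\<^bsub>T\<^esub> n)"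
  proof (induction n)
    case (Suc n)
    then obtain x' y' where "x' \<in> carrier F" "y' \<in> carrier E" "(((x, c), (y, d)), t) [^]\<^bsub>G\<^esub> n
      = (((x', c [^]\<^bsub>C\<^esub> n), (y', d [^]\<^bsub>D\<^esub> n)), t [^]\<^bsub>T\<^esub> n)" by blast
    then show ?case
      using assms(1) by (auto simp: mult_G)
  qed (auto simp: one_G)
  then show "c [^]\<^bsub>C\<^esub> n = \<one>\<^bsub>C\<^esub>" "d [^]\<^bsub>D\<^esub> n = \<one>\<^bsub>D\<^esub>" "t [^]\<^bsub>T\<^esub> n = \<one>\<^bsub>T\<^esub>"
    using assms(2) by (auto simp: one_G)
qed

lemma pow_complement:
  assumes "c \<in> carrier C" "d \<in> carrier D" "t \<in> carrier T"
  shows "(((\<zero>\<^bsub>F\<^esub>, c), (\<zero>\<^bsub>E\<^esub>, d)), t) [^]\<^bsub>G\<^esub> (n::nat)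
    = (((\<zero>\<^bsub>F\<^esub>, c [^]\<^bsub>C\<^esub> n), (\<zero>\<^bsub>E\<^esub>, d [^]\<^bsub>D\<^esub> n)), t [^]\<^bsub>T\<^esub> n)"
  using assms by (induction n) (auto simp: one_G mult_G)

lemma pow_base:
  assumes "x \<in> carrier F" "y \<in> carrier E"
  shows "(((x, \<one>\<^bsub>C\<^esub>), (y, \<one>\<^bsub>D\<^esub>)), \<one>\<^bsub>T\<^esub>) [^]\<^bsub>G\<^esub> (n::nat)
    = (((x [^]\<^bsub>add_monoid F\<^esub> n, \<one>\<^bsub>C\<^esub>), (y [^]\<^bsub>add_monoid E\<^esub> n, \<one>\<^bsub>D\<^esub>)), \<one>\<^bsub>T\<^esub>)"
proof (induction n)
  case (Suc n)
  have "x [^]\<^bsub>add_monoid F\<^esub> n \<in> carrier F" "y [^]\<^bsub>add_monoid E\<^esub> n \<in> carrier E"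
    using assms monoid.nat_pow_closed[OF F.a_monoid, of x n] monoid.nat_pow_closed[OF E.a_monoid, of y n]
    by simp_all
  then show ?case
    using Suc assms by (auto simp: mult_G)
qed (auto simp: one_G)

section \<open>Metabelian with abelian Sylow subgroups\<close>

lemma metabelian_G: "metabelian_group G"
proof -
  let ?\<pi> = "\<lambda>(((x, c), (y, d)), t). (c, d, t)"
  let ?Q = "C \<times>\<times> (D \<times>\<times> T)"
  have Q: "group ?Q"
    by (intro DirProd_group C.is_group D.is_group T.is_group)
  interpret Q: comm_group ?Q
    by (rule group.group_comm_groupI[OF Q]) (auto simp: C.m_comm D.m_comm T.m_comm)
  interpret \<pi>: group_hom G ?Q ?\<pi>
    using projections by unfold_locales
  let ?N = "kernel G ?Q ?\<pi>"
  have N: "?N = {(((x, \<one>\<^bsub>C\<^esub>), (y, \<one>\<^bsub>D\<^esub>)), \<one>\<^bsub>T\<^esub>) | x y. x \<in> carrier F \<and> y \<in> carrier E}"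
    by (auto simp: kernel_def carrier_G)
  have "comm_group (G\<lparr>carrier := ?N\<rparr>)"
    using \<pi>.subgroup_kernel
    by (intro group.group_comm_groupI subgroup.subgroup_is_group group_G)
      (auto simp: N mult_G F.a_comm E.a_comm)
  moreover have "?\<pi> ` carrier G = carrier ?Q"
    by (force simp: carrier_G image_iff)
  then have "G Mod ?N \<cong> ?Q"
    by (rule \<pi>.FactGroup_iso)
  then have "comm_group (G Mod ?N)"
    using Q.iso_imp_comm_group normal.factorgroup_is_group[OF \<pi>.normal_kernel]
      group.iso_sym group.is_monoid by blast
  ultimately show ?thesis
    using \<pi>.normal_kernel unfolding metabelian_group_def by blast
qed

lemma A_group_G: "A_group G"
  unfolding A_group_def
proof (intro conjI allI impI group_G finite_G, elim conjE)
  fix l P assume l: "Factorial_Ring.prime l" and "sylow_subgroup l P G"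
  then obtain k where P: "subgroup P G" "card P = l ^ k"
    by (auto simp: sylow_subgroup_def)
  interpret P: group "G\<lparr>carrier := P\<rparr>"
    by (rule subgroup.subgroup_is_group[OF P(1) group_G])
  have pow: "u [^]\<^bsub>G\<^esub> (l ^ k) = \<one>\<^bsub>G\<^esub>" if "u \<in> P" for u
    using P.pow_order_eq_1[of u] that P(2) by (simp add: order_def flip: G.nat_pow_consistent)
  have cop: "coprime (l ^ k) (m ^ j)" if "Factorial_Ring.prime m" "l \<noteq> m" for m j
    using l that by (simp add: primes_coprime)
  show "comm_group (G\<lparr>carrier := P\<rparr>)"
  proof (rule P.group_comm_groupI, simp)
    fix u v assume uv: "u \<in> P" "v \<in> P"
    obtain x c y d t where u: "u = (((x, c), (y, d)), t)" by (metis surj_pair)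
    obtain x' c' y' d' t' where v: "v = (((x', c'), (y', d')), t')" by (metis surj_pair)
    have uG: "u \<in> carrier G" and vG: "v \<in> carrier G"
      using uv subgroup.subset[OF P(1)] by auto
    note mem = uG[unfolded u mem_G] vG[unfolded v mem_G]
    define w where "w = u \<otimes>\<^bsub>G\<^esub> v \<otimes>\<^bsub>G\<^esub> inv\<^bsub>G\<^esub> (v \<otimes>\<^bsub>G\<^esub> u)"
    have "w \<in> P"
      using uv unfolding w_def by (intro subgroup.m_closed[OF P(1)] subgroup.m_inv_closed[OF P(1)])
    then have wG: "w \<in> carrier G"
      using subgroup.subset[OF P(1)] by auto
    have wvu: "w \<otimes>\<^bsub>G\<^esub> (v \<otimes>\<^bsub>G\<^esub> u) = u \<otimes>\<^bsub>G\<^esub> v"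
      using uG vG by (simp add: w_def G.m_assoc)
    obtain x0 c0 y0 d0 t0 where w: "w = (((x0, c0), (y0, d0)), t0)" by (metis surj_pair)
    note mem = mem wG[unfolded w mem_G]
    have eqs: "x0 \<oplus>\<^bsub>F\<^esub> \<chi>\<^sub>1 c0 t0 \<otimes>\<^bsub>F\<^esub> (x' \<oplus>\<^bsub>F\<^esub> \<chi>\<^sub>1 c' t' \<otimes>\<^bsub>F\<^esub> x) = x \<oplus>\<^bsub>F\<^esub> \<chi>\<^sub>1 c t \<otimes>\<^bsub>F\<^esub> x'"
      "y0 \<oplus>\<^bsub>E\<^esub> \<chi>\<^sub>2 d0 t0 \<otimes>\<^bsub>E\<^esub> (y' \<oplus>\<^bsub>E\<^esub> \<chi>\<^sub>2 d' t' \<otimes>\<^bsub>E\<^esub> y) = y \<oplus>\<^bsub>E\<^esub> \<chi>\<^sub>2 d t \<otimes>\<^bsub>E\<^esub> y'"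
      "c0 \<otimes>\<^bsub>C\<^esub> (c' \<otimes>\<^bsub>C\<^esub> c) = c \<otimes>\<^bsub>C\<^esub> c'" "d0 \<otimes>\<^bsub>D\<^esub> (d' \<otimes>\<^bsub>D\<^esub> d) = d \<otimes>\<^bsub>D\<^esub> d'"
      "t0 \<otimes>\<^bsub>T\<^esub> (t' \<otimes>\<^bsub>T\<^esub> t) = t \<otimes>\<^bsub>T\<^esub> t'"
      using wvu mem by (simp_all add: u v w mult_G)
    \<comment> \<open>The commutator \<open>w\<close> lies in \<open>F \<times> E\<close>.\<close>
    have 1: "c0 = \<one>\<^bsub>C\<^esub>" "d0 = \<one>\<^bsub>D\<^esub>" "t0 = \<one>\<^bsub>T\<^esub>"
      using eqs(3-5) mem
      by (simp_all add: C.m_comm[of c' c] D.m_comm[of d' d] T.m_comm[of t' t])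
    have pw: "x0 [^]\<^bsub>add_monoid F\<^esub> (l ^ k) = \<zero>\<^bsub>F\<^esub>" "y0 [^]\<^bsub>add_monoid E\<^esub> (l ^ k) = \<zero>\<^bsub>E\<^esub>"
      using pow[OF \<open>w \<in> P\<close>] mem by (simp_all add: w 1 pow_base one_G)
    have cC: "e = \<one>\<^bsub>C\<^esub>" if "e \<in> carrier C" "e [^]\<^bsub>C\<^esub> (l ^ k) = \<one>\<^bsub>C\<^esub>" "l \<noteq> q" for e
      using C.eq_one_if_pow_coprime[OF that(1,2)] cop[OF prime(2) that(3), of 1] ord by simp
    have cD: "e = \<one>\<^bsub>D\<^esub>" if "e \<in> carrier D" "e [^]\<^bsub>D\<^esub> (l ^ k) = \<one>\<^bsub>D\<^esub>" "l \<noteq> p" for e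
      using D.eq_one_if_pow_coprime[OF that(1,2)] cop[OF prime(1) that(3), of 1] ord by simp
    have cT: "e = \<one>\<^bsub>T\<^esub>" if "e \<in> carrier T" "e [^]\<^bsub>T\<^esub> (l ^ k) = \<one>\<^bsub>T\<^esub>" "l \<noteq> r" for e
      using T.eq_one_if_pow_coprime[OF that(1,2)] cop[OF prime(3) that(3), of 1] ord by simp
    note up = pow_G_components[OF uG[unfolded u] pow[OF uv(1), unfolded u]]
    note vp = pow_G_components[OF vG[unfolded v] pow[OF uv(2), unfolded v]]
    \<comment> \<open>A \<open>p\<close>-subgroup has trivial components in \<open>C\<close> and \<open>T\<close>, so it acts trivially on \<open>F\<close>.\<close>
    have "x0 = \<zero>\<^bsub>F\<^esub>"
    proof (cases "l = p")
      case True
      then have "c = \<one>\<^bsub>C\<^esub>" "t = \<one>\<^bsub>T\<^esub>" "c' = \<one>\<^bsub>C\<^esub>" "t' = \<one>\<^bsub>T\<^esub>"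
        using cC cT up vp distinct mem by auto
      then show ?thesis
        using eqs(1) mem by (simp add: 1 F.a_comm[of x' x])
    next
      case False
      then have "coprime (l ^ k) (order (add_monoid F))"
        using cop[OF prime(1) False, of a] ord(1) by (simp add: order_def)
      from group.eq_one_if_pow_coprime[OF F.a_group _ _ this, of x0] show ?thesis
        using pw(1) mem by simp
    qed
    moreover have "y0 = \<zero>\<^bsub>E\<^esub>"
    proof (cases "l = q")
      case True
      then have "d = \<one>\<^bsub>D\<^esub>" "t = \<one>\<^bsub>T\<^esub>" "d' = \<one>\<^bsub>D\<^esub>" "t' = \<one>\<^bsub>T\<^esub>"
        using cD cT up vp distinct mem by auto
      then show ?thesis
        using eqs(2) mem by (simp add: 1 E.a_comm[of y' y])
    next
      case False
      then have "coprime (l ^ k) (order (add_monoid E))"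
        using cop[OF prime(2) False, of b] ord(2) by (simp add: order_def)
      from group.eq_one_if_pow_coprime[OF E.a_group _ _ this, of y0] show ?thesis
        using pw(2) mem by simp
    qed
    ultimately have "w = \<one>\<^bsub>G\<^esub>"
      by (simp add: w 1 one_G)
    then show "u \<otimes>\<^bsub>G\<^esub> v = v \<otimes>\<^bsub>G\<^esub> u"
      using wvu uG vG by simp
  qed
qed

section \<open>Not an A'-group\<close>

text \<open>For \<open>g = (c, d, t)\<close> in the complement and \<open>y = (1, 1) \<in> F \<times> E\<close> the commutator is
  \<open>z = (\<chi>\<^sub>1 c t - 1, \<chi>\<^sub>2 d t - 1)\<close>, and \<open>g\<close> acts on it by the scalars \<open>\<chi>\<^sub>1 c t\<close> and \<open>\<chi>\<^sub>2 d t\<close>, at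
  least one of which is not \<open>1\<close>.\<close>

lemma noncommuting_commutator:
  assumes cdt: "c \<in> carrier C" "d \<in> carrier D" "t \<in> carrier T"
    and pow: "c [^]\<^bsub>C\<^esub> (l::nat) = \<one>\<^bsub>C\<^esub>" "d [^]\<^bsub>D\<^esub> l = \<one>\<^bsub>D\<^esub>" "t [^]\<^bsub>T\<^esub> l = \<one>\<^bsub>T\<^esub>"
    and ne: "(c, d, t) \<noteq> (\<one>\<^bsub>C\<^esub>, \<one>\<^bsub>D\<^esub>, \<one>\<^bsub>T\<^esub>)"
  shows "\<exists>g\<in>carrier G. \<exists>y\<in>carrier G. \<exists>z\<in>carrier G. g [^]\<^bsub>G\<^esub> l = \<one>\<^bsub>G\<^esub>
        \<and> g \<otimes>\<^bsub>G\<^esub> y = z \<otimes>\<^bsub>G\<^esub> (y \<otimes>\<^bsub>G\<^esub> g) \<and> g \<otimes>\<^bsub>G\<^esub> z \<noteq> z \<otimes>\<^bsub>G\<^esub> g"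
proof -
  define h k where "h = \<chi>\<^sub>1 c t" and "k = \<chi>\<^sub>2 d t"
  have hk: "h \<in> carrier F" "k \<in> carrier E"
    using cdt by (simp_all add: h_def k_def)
  have ne: "h \<noteq> \<one>\<^bsub>F\<^esub> \<or> k \<noteq> \<one>\<^bsub>E\<^esub>"
    using ne \<chi>\<^sub>1_eq_one \<chi>\<^sub>2_eq_one cdt by (auto simp: h_def k_def)
  define g where "g = (((\<zero>\<^bsub>F\<^esub>, c), (\<zero>\<^bsub>E\<^esub>, d)), t)"
  define y where "y = (((\<one>\<^bsub>F\<^esub>, \<one>\<^bsub>C\<^esub>), (\<one>\<^bsub>E\<^esub>, \<one>\<^bsub>D\<^esub>)), \<one>\<^bsub>T\<^esub>)"
  define z where "z = (((h \<ominus>\<^bsub>F\<^esub> \<one>\<^bsub>F\<^esub>, \<one>\<^bsub>C\<^esub>), (k \<ominus>\<^bsub>E\<^esub> \<one>\<^bsub>E\<^esub>, \<one>\<^bsub>D\<^esub>)), \<one>\<^bsub>T\<^esub>)"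
  have G: "g \<in> carrier G" "y \<in> carrier G" "z \<in> carrier G"
    using cdt hk by (simp_all add: g_def y_def z_def)
  have "g [^]\<^bsub>G\<^esub> l = \<one>\<^bsub>G\<^esub>"
    using cdt pow by (simp add: g_def pow_complement one_G)
  moreover have "h \<ominus>\<^bsub>F\<^esub> \<one>\<^bsub>F\<^esub> \<oplus>\<^bsub>F\<^esub> \<one>\<^bsub>F\<^esub> = h" "k \<ominus>\<^bsub>E\<^esub> \<one>\<^bsub>E\<^esub> \<oplus>\<^bsub>E\<^esub> \<one>\<^bsub>E\<^esub> = k"
    using hk by (simp_all add: F.minus_eq E.minus_eq F.a_assoc E.a_assoc F.l_neg E.l_neg)
  then have "g \<otimes>\<^bsub>G\<^esub> y = z \<otimes>\<^bsub>G\<^esub> (y \<otimes>\<^bsub>G\<^esub> g)"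
    using cdt hk by (simp add: g_def y_def z_def mult_G flip: h_def k_def)
  moreover have "g \<otimes>\<^bsub>G\<^esub> z \<noteq> z \<otimes>\<^bsub>G\<^esub> g"
  proof
    assume "g \<otimes>\<^bsub>G\<^esub> z = z \<otimes>\<^bsub>G\<^esub> g"
    then have "h \<otimes>\<^bsub>F\<^esub> (h \<ominus>\<^bsub>F\<^esub> \<one>\<^bsub>F\<^esub>) = h \<ominus>\<^bsub>F\<^esub> \<one>\<^bsub>F\<^esub>" "k \<otimes>\<^bsub>E\<^esub> (k \<ominus>\<^bsub>E\<^esub> \<one>\<^bsub>E\<^esub>) = k \<ominus>\<^bsub>E\<^esub> \<one>\<^bsub>E\<^esub>"
      using cdt hk by (simp_all add: g_def z_def mult_G flip: h_def k_def)
    then show False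
      using ne hk F.scaling_fixed_eq_zero[of h "h \<ominus>\<^bsub>F\<^esub> \<one>\<^bsub>F\<^esub>"] E.scaling_fixed_eq_zero[of k "k \<ominus>\<^bsub>E\<^esub> \<one>\<^bsub>E\<^esub>"]
      by auto
  qed
  ultimately show ?thesis
    using G by blast
qed

lemma noncommuting_commutator_prime:
  assumes l: "Factorial_Ring.prime l" "l dvd order G"
  shows "\<exists>g\<in>carrier G. \<exists>y\<in>carrier G. \<exists>z\<in>carrier G. g [^]\<^bsub>G\<^esub> l = \<one>\<^bsub>G\<^esub>
        \<and> g \<otimes>\<^bsub>G\<^esub> y = z \<otimes>\<^bsub>G\<^esub> (y \<otimes>\<^bsub>G\<^esub> g) \<and> g \<otimes>\<^bsub>G\<^esub> z \<noteq> z \<otimes>\<^bsub>G\<^esub> g"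
proof -
  have "l = p \<or> l = q \<or> l = r"
    using l(2) prime_dvd_order_base[OF l(1)] primes_dvd_imp_eq[OF l(1) prime(3)] unfolding order_G
    by (auto simp only: prime_dvd_mult_iff[OF l(1)])
  then consider "l = q" | "l = p" | "l = r" by blast
  then show ?thesis
  proof cases
    case 1
    obtain c where "c \<in> carrier C" "c \<noteq> \<one>\<^bsub>C\<^esub>"
      using C.ex_non_one_if_prime_order prime ord by auto
    then show ?thesis
      using noncommuting_commutator[of c "\<one>\<^bsub>D\<^esub>" "\<one>\<^bsub>T\<^esub>" l] C.pow_order_eq_1 ord 1 by simp
  next
    case 2
    obtain d where "d \<in> carrier D" "d \<noteq> \<one>\<^bsub>D\<^esub>"
      using D.ex_non_one_if_prime_order prime ord by auto
    then show ?thesis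
      using noncommuting_commutator[of "\<one>\<^bsub>C\<^esub>" d "\<one>\<^bsub>T\<^esub>" l] D.pow_order_eq_1 ord 2 by simp
  next
    case 3
    obtain t where "t \<in> carrier T" "t \<noteq> \<one>\<^bsub>T\<^esub>"
      using T.ex_non_one_if_prime_order prime ord by auto
    then show ?thesis
      using noncommuting_commutator[of "\<one>\<^bsub>C\<^esub>" "\<one>\<^bsub>D\<^esub>" t l] T.pow_order_eq_1 ord 3 by simp
  qed
qed

text \<open>The centraliser of \<open>\<tau>\<close> is the complement \<open>C \<times> D \<times> T\<close> of \<open>F \<times> E\<close>; conjugating \<open>u = (c, d, s)\<close>
  by \<open>g = (1, 1) \<in> F \<times> E\<close> gives the component \<open>(1 - \<chi>\<^sub>1 c s, 1 - \<chi>\<^sub>2 d s)\<close> in \<open>F \<times> E\<close>, which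
  vanishes only if \<open>u\<close> is trivial.\<close>

lemma centraliser_core_trivial:
  assumes t: "t \<in> carrier T" "t \<noteq> \<one>\<^bsub>T\<^esub>"
  defines "\<tau> \<equiv> (((\<zero>\<^bsub>F\<^esub>, \<one>\<^bsub>C\<^esub>), (\<zero>\<^bsub>E\<^esub>, \<one>\<^bsub>D\<^esub>)), t)"
  assumes u: "u \<in> carrier G"
    and conj: "\<And>g u'. \<lbrakk>g \<in> carrier G; u' \<in> carrier G; u' \<otimes>\<^bsub>G\<^esub> g = g \<otimes>\<^bsub>G\<^esub> u\<rbrakk> \<Longrightarrow> u' \<otimes>\<^bsub>G\<^esub> \<tau> = \<tau> \<otimes>\<^bsub>G\<^esub> u'"
  shows "u = \<one>\<^bsub>G\<^esub>"
proof -
  have cent: "x = \<zero>\<^bsub>F\<^esub> \<and> y = \<zero>\<^bsub>E\<^esub>"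
    if m: "(((x, c), (y, d)), s) \<in> carrier G"
      and eq: "(((x, c), (y, d)), s) \<otimes>\<^bsub>G\<^esub> \<tau> = \<tau> \<otimes>\<^bsub>G\<^esub> (((x, c), (y, d)), s)" for x c y d s
  proof -
    have "\<chi>\<^sub>1 \<one>\<^bsub>C\<^esub> t \<otimes>\<^bsub>F\<^esub> x = x" "\<chi>\<^sub>2 \<one>\<^bsub>D\<^esub> t \<otimes>\<^bsub>E\<^esub> y = y"
      using eq m t by (simp_all add: \<tau>_def mult_G)
    moreover have "\<chi>\<^sub>1 \<one>\<^bsub>C\<^esub> t \<noteq> \<one>\<^bsub>F\<^esub>" "\<chi>\<^sub>2 \<one>\<^bsub>D\<^esub> t \<noteq> \<one>\<^bsub>E\<^esub>"
      using t \<chi>\<^sub>1_eq_one \<chi>\<^sub>2_eq_one by blast+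
    ultimately show ?thesis
      using m t F.scaling_fixed_eq_zero[of "\<chi>\<^sub>1 \<one>\<^bsub>C\<^esub> t" x] E.scaling_fixed_eq_zero[of "\<chi>\<^sub>2 \<one>\<^bsub>D\<^esub> t" y]
      by simp
  qed
  obtain x c y d s where ueq: "u = (((x, c), (y, d)), s)" by (metis surj_pair)
  note m = u[unfolded ueq mem_G]
  have xy: "x = \<zero>\<^bsub>F\<^esub>" "y = \<zero>\<^bsub>E\<^esub>"
    using cent conj[of "\<one>\<^bsub>G\<^esub>" u] u by (auto simp: ueq)
  define h k where "h = \<chi>\<^sub>1 c s" and "k = \<chi>\<^sub>2 d s"
  have hk: "h \<in> carrier F" "k \<in> carrier E"
    using m by (simp_all add: h_def k_def)
  define g where "g = (((\<one>\<^bsub>F\<^esub>, \<one>\<^bsub>C\<^esub>), (\<one>\<^bsub>E\<^esub>, \<one>\<^bsub>D\<^esub>)), \<one>\<^bsub>T\<^esub>)"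
  define u' where "u' = (((\<one>\<^bsub>F\<^esub> \<ominus>\<^bsub>F\<^esub> h, c), (\<one>\<^bsub>E\<^esub> \<ominus>\<^bsub>E\<^esub> k, d)), s)"
  have "g \<in> carrier G" "u' \<in> carrier G"
    using m hk by (simp_all add: g_def u'_def)
  moreover have "\<one>\<^bsub>F\<^esub> \<ominus>\<^bsub>F\<^esub> h \<oplus>\<^bsub>F\<^esub> h = \<one>\<^bsub>F\<^esub>" "\<one>\<^bsub>E\<^esub> \<ominus>\<^bsub>E\<^esub> k \<oplus>\<^bsub>E\<^esub> k = \<one>\<^bsub>E\<^esub>"
    using hk by (simp_all add: F.minus_eq E.minus_eq F.a_assoc E.a_assoc F.l_neg E.l_neg)
  then have "u' \<otimes>\<^bsub>G\<^esub> g = g \<otimes>\<^bsub>G\<^esub> u"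
    using m hk by (simp add: g_def u'_def ueq xy mult_G flip: h_def k_def)
  ultimately have "\<one>\<^bsub>F\<^esub> \<ominus>\<^bsub>F\<^esub> h = \<zero>\<^bsub>F\<^esub> \<and> \<one>\<^bsub>E\<^esub> \<ominus>\<^bsub>E\<^esub> k = \<zero>\<^bsub>E\<^esub>"
    using conj[of g u'] cent unfolding u'_def by blast
  then have "\<chi>\<^sub>1 c s = \<one>\<^bsub>F\<^esub>" "\<chi>\<^sub>2 d s = \<one>\<^bsub>E\<^esub>"
    using hk by (auto simp flip: h_def k_def)
  then show ?thesis
    using \<chi>\<^sub>1_eq_one[of c s] \<chi>\<^sub>2_eq_one[of d s] m by (simp add: ueq xy one_G)
qed

lemma not_A'_group_G: "\<not> A'_group G"
proof
  assume "A'_group G"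
  then obtain K h where K: "A'_nat K" "h \<in> iso G K"
    by (auto simp: A'_group_def is_iso_def)
  obtain t where t: "t \<in> carrier T" "t \<noteq> \<one>\<^bsub>T\<^esub>"
    using T.ex_non_one_if_prime_order prime ord by auto
  have "\<not> r dvd (p ^ a * q) * (q ^ b * p)"
    using prime_dvd_order_base[OF prime(3)] distinct by blast
  then have r: "r dvd order G" "\<not> r * r dvd order G"
    using prime(3) unfolding order_G by auto
  let ?t = "(((\<zero>\<^bsub>F\<^esub>, \<one>\<^bsub>C\<^esub>), (\<zero>\<^bsub>E\<^esub>, \<one>\<^bsub>D\<^esub>)), t)"
  have "?t \<in> carrier G" "?t [^]\<^bsub>G\<^esub> r = \<one>\<^bsub>G\<^esub>"
    using t T.pow_order_eq_1 ord by (auto simp: pow_complement one_G)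
  then show False
    using not_A'_nat_if_iso[OF K group_G noncommuting_commutator_prime prime(3) r]
      centraliser_core_trivial[OF t] by blast
qed

end

theorem proposition2p2:
  fixes p q r a b :: nat
    and F :: "('a, 'm) ring_scheme" and E :: "('b, 'n) ring_scheme"
    and \<phi> \<rho>\<^sub>1 :: "int \<Rightarrow> 'a" and \<psi> \<rho>\<^sub>2 :: "int \<Rightarrow> 'b"
  defines "H\<^sub>1 \<equiv> affine_group F (integer_mod_group q) \<phi>"
    and "H\<^sub>2 \<equiv> affine_group E (integer_mod_group p) \<psi>"
  defines "G \<equiv> semidirect (H\<^sub>1 \<times>\<times> H\<^sub>2) (integer_mod_group r)
      (affine_pair_action F (integer_mod_group q) \<rho>\<^sub>1 E (integer_mod_group p) \<rho>\<^sub>2)"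
  assumes "Factorial_Ring.prime p" "Factorial_Ring.prime q" "Factorial_Ring.prime r"
    and "p \<noteq> q" "p \<noteq> r" "q \<noteq> r"
    and "a > 0" "b > 0"
    and "q * r dvd p ^ a - 1" "p * r dvd q ^ b - 1"
    and "field F" "order F = p ^ a"
    and "field E" "order E = q ^ b"
    and "\<phi> \<in> mon (integer_mod_group q) (Multiplicative_Group.mult_of F)"
    and "\<psi> \<in> mon (integer_mod_group p) (Multiplicative_Group.mult_of E)"
    and "\<rho>\<^sub>1 \<in> mon (integer_mod_group r) (Multiplicative_Group.mult_of F)"
    and "\<rho>\<^sub>2 \<in> mon (integer_mod_group r) (Multiplicative_Group.mult_of E)"
  shows "metabelian_group G \<and> A_group G \<and> \<not> A'_group G"
proof -
  have order: "order (integer_mod_group n) = n" if "n > 0" for n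
    using that by (simp add: order_def carrier_integer_mod_group)
  interpret affine_pair F E "integer_mod_group q" "integer_mod_group p" "integer_mod_group r"
    \<phi> \<psi> \<rho>\<^sub>1 \<rho>\<^sub>2 p q r a b
    using assms by (intro affine_pair.intro affine_pair_axioms.intro) (simp_all add: order prime_gt_0_nat)
  have "affine_pair.G F E (integer_mod_group q) (integer_mod_group p) (integer_mod_group r) \<phi> \<psi> \<rho>\<^sub>1 \<rho>\<^sub>2 = G"
    unfolding G_def assms(1-3) ..
  then show ?thesis
    using metabelian_G A_group_G not_A'_group_G by simp
qed

end
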